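(* Let $m,n\geq 1$ be integers with $m\not\equiv 0\pmod 3$. Then $$\sum_{0\le r_1,\ldots,r_{m}\leq n}\ \prod_{k=1}^{m}{n-r_k\brack r_{k+1}}q^{\binom{r_k}{2}}(-1)^{r_k}=\begin{cases}(-1)^{\lfloor (m+n-1)m/3\rfloor}\, q^{mn(n-1)/6},&\text{if } n\not\equiv 2 \pmod 3,\\ 0,&\text{if } n\equiv 2 \pmod 3,\end{cases}$$ where the sum is over integers $r_1,\ldots,r_m$ and $r_{m+1}=r_1$.
   Context: Here $q$ is an indeterminate. The $q$-binomial coefficient is defined for integers $n,k$ by ${n\brack k}=\prod_{i=1}^{k}\frac{1-q^{n-i+1}}{1-q^i}$ if $0\leq k\leq n$, and ${n\brack k}=0$ otherwise. Also $\binom{r}{2}=r(r-1)/2$. *)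

theory Defs
  imports "HOL-Computational_Algebra.Computational_Algebra" "HOL-Library.FuncSet"
begin

definition qbinom :: "'a::field \<Rightarrow> int \<Rightarrow> int \<Rightarrow> 'a" where
  "qbinom q n k =
     (if 0 \<le> k \<and> k \<le> n
      then \<Prod>i\<in>{1..k}. (1 - q powi (n - i + 1)) / (1 - q powi i)
      else 0)"

text \<open>The indeterminate \<open>q\<close>, as the generator of the field \<open>\<rat>(q)\<close> of rational functions.\<close>

definition qvar :: "rat poly fract" where
  "qvar = to_fract [:0, 1:]"

end

theory Submission
  imports Defs
begin

text \<open>
  The sum is the trace of \<open>M ^ m\<close> for the \<open>(n + 1) \<times> (n + 1)\<close> matrix with entries
  \<open>M x y = [n - x, y] q ^ (x choose 2) (- 1) ^ x\<close>. A \<open>q\<close>-Vandermonde type identity gives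
  \<open>M\<^sup>2\<close> in closed form and then \<open>M\<^sup>3 = (- 1) ^ n q ^ (n choose 2)\<close>, so only the traces of \<open>M\<close> and
  \<open>M\<^sup>2\<close> matter. As functions of \<open>n\<close> these satisfy \<open>f (n + 3) = - q ^ (n + 1) f n\<close> and
  \<open>f (n + 3) = q ^ (2 n + 2) f n\<close> respectively: combine the two \<open>q\<close>-Pascal rules, using an
  auxiliary sum with an extra factor \<open>q ^ k\<close> or \<open>q ^ (- k)\<close>.
\<close>

section \<open>Recursive \<open>q\<close>-binomial coefficients\<close>

text \<open>The recursion is the first \<open>q\<close>-Pascal rule. It avoids division, so
  everything up to the comparison with \<open>qbinom\<close> makes sense in any commutative
  ring.\<close>

fun qb :: "'a::comm_ring_1 \<Rightarrow> nat \<Rightarrow> nat \<Rightarrow> 'a" where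
  "qb q n 0 = 1"
| "qb q 0 (Suc k) = 0"
| "qb q (Suc n) (Suc k) = qb q n k + q ^ Suc k * qb q n (Suc k)"

lemma qb_eq_0: "n < k \<Longrightarrow> qb q n k = 0"
  by (induction q n k rule: qb.induct) auto

lemma qb_self [simp]: "qb q n n = 1"
  by (induction n) (auto simp: qb_eq_0)

text \<open>The second \<open>q\<close>-Pascal rule, by induction: expand with the recursion, apply
  the hypothesis to both terms, and regroup. For \<open>k > n\<close> the truncated exponent is
  harmless because \<open>qb q n k\<close> vanishes.\<close>

lemma qb_Suc_Suc': "qb q (Suc n) (Suc k) = qb q n (Suc k) + q ^ (n - k) * qb q n k"
proof (induction n arbitrary: k)
  case 0
  then show ?case by (cases k) auto
next
  case (Suc n)
  show ?case
  proof (cases "k \<le> n")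
    case False
    then show ?thesis
      by (cases "k = Suc n") (auto simp: qb_eq_0 simp del: qb.simps(3))
  next
    case True
    show ?thesis
    proof (cases k)
      case 0
      have "qb q (Suc (Suc n)) (Suc 0) = 1 + q * qb q (Suc n) (Suc 0)"
        by simp
      also have "\<dots> = 1 + q * (qb q n (Suc 0) + q ^ n)"
        by (simp only: Suc.IH) simp
      also have "\<dots> = qb q (Suc n) (Suc 0) + q ^ Suc n"
        by (simp add: algebra_simps)
      finally show ?thesis using 0 by simp
    next
      case (Suc j)
      \<comment> \<open>With this \<open>d\<close> the truncated exponents \<open>n - j\<close> and
        \<open>n - k\<close> become \<open>d + 1\<close> and \<open>d\<close>.\<close>
      obtain d where d: "n = Suc (j + d)"
        using True Suc by (metis add_Suc le_Suc_ex)
      have "qb q (Suc (Suc n)) (Suc k) = qb q (Suc n) k + q ^ Suc k * qb q (Suc n) (Suc k)"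
        by simp
      also have "\<dots> = (qb q n k + q ^ (n - j) * qb q n j)
          + q ^ Suc k * (qb q n (Suc k) + q ^ (n - k) * qb q n k)"
        unfolding Suc.IH[of k] by (simp only: Suc Suc.IH)
      also have "\<dots> = (qb q n k + q ^ Suc k * qb q n (Suc k))
          + q ^ (n - j) * (qb q n j + q ^ k * qb q n k)"
        by (simp add: Suc d algebra_simps power_add)
      also have "\<dots> = qb q (Suc n) (Suc k) + q ^ (Suc n - k) * qb q (Suc n) k"
        by (simp add: Suc)
      finally show ?thesis .
    qed
  qed
qed

text \<open>Replacing \<open>k\<close> by \<open>n - k\<close> exchanges the two Pascal rules, so
  each side is expanded by a different one.\<close>

lemma qb_symmetric: "k \<le> n \<Longrightarrow> qb q n (n - k) = qb q n k"
proof (induction n arbitrary: k)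
  case (Suc n)
  show ?case
  proof (cases "k = 0 \<or> k = Suc n")
    case False
    then obtain j where k: "k = Suc j" and j: "j < n"
      using Suc.prems by (metis Suc_leD Suc_le_lessD le_SucE less_Suc_eq_le not0_implies_Suc)
    then have n: "Suc n - k = Suc (n - Suc j)" "n - (n - Suc j) = Suc j" "Suc (n - Suc j) = n - j"
      by auto
    have "qb q (Suc n) (Suc n - k) = qb q n (n - j) + q ^ Suc j * qb q n (n - Suc j)"
      using qb_Suc_Suc'[of q n "n - Suc j"] by (simp only: n)
    then show ?thesis
      using Suc.IH[of j] Suc.IH[of "Suc j"] k j by simp
  qed auto
qed simp

text \<open>Expand one copy of the coefficient by the first rule and the copy multiplied by
  \<open>q ^ Suc k\<close> by the second: the terms with \<open>qb q n (Suc k)\<close>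
  cancel.\<close>

lemma qb_absorb:
  "k \<le> n \<Longrightarrow> qb q (Suc n) (Suc k) * (1 - q ^ Suc k) = (1 - q ^ Suc n) * qb q n k"
proof -
  assume "k \<le> n"
  then have e: "q ^ Suc n = q ^ Suc k * q ^ (n - k)"
    by (simp add: mult.assoc flip: power_add)
  have "qb q (Suc n) (Suc k) * (1 - q ^ Suc k)
      = (qb q n k + q ^ Suc k * qb q n (Suc k))
        - q ^ Suc k * (qb q n (Suc k) + q ^ (n - k) * qb q n k)"
    unfolding qb_Suc_Suc'[symmetric] qb.simps(3)[symmetric]
    by (simp only: algebra_simps mult_1_left mult_1_right)
  also have "\<dots> = (1 - q ^ Suc n) * qb q n k"
    unfolding e by (simp add: algebra_simps)
  finally show ?thesis .
qed

text \<open>Absorption iterated \<open>k\<close> times: the product formula with its denominators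
  cleared.\<close>

lemma qb_mult_prod:
  "k \<le> n \<Longrightarrow> qb q n k * (\<Prod>i=1..k. 1 - q ^ i) = (\<Prod>i=1..k. 1 - q ^ (n + 1 - i))"
proof (induction k arbitrary: n)
  case (Suc k)
  then obtain p where n: "n = Suc p" and p: "k \<le> p"
    by (metis Suc_le_D Suc_le_mono)
  have "qb q n (Suc k) * (\<Prod>i=1..Suc k. 1 - q ^ i)
      = (qb q (Suc p) (Suc k) * (1 - q ^ Suc k)) * (\<Prod>i=1..k. 1 - q ^ i)"
    by (simp only: n prod.nat_ivl_Suc' ac_simps)
  also have "\<dots> = (1 - q ^ Suc p) * (\<Prod>i=1..k. 1 - q ^ (p + 1 - i))"
    using Suc.IH[OF p] qb_absorb[OF p, of q] by (simp only: mult.assoc)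
  also have "\<dots> = (\<Prod>i=1..Suc k. 1 - q ^ (n + 1 - i))"
    using prod.atLeast_Suc_atMost[of 1 "Suc k" "\<lambda>i. 1 - q ^ (n + 1 - i)"]
    by (simp add: n prod.atLeast_Suc_atMost_Suc_shift del: prod.cl_ivl_Suc)
  finally show ?case .
qed simp

text \<open>The assumption makes every denominator \<open>1 - q ^ i\<close> nonzero, so the cleared
  product formula can be divided out.\<close>

lemma qbinom_eq_qb:
  assumes "\<And>i. i > 0 \<Longrightarrow> q ^ i \<noteq> 1"
  shows "qbinom q (int n) (int k) = qb q n k"
proof (cases "k \<le> n")
  case True
  have img: "{1..int k} = int ` {1..k}"
    by (simp add: image_int_atLeastAtMost)
  have "qbinom q (int n) (int k)
      = (\<Prod>i=1..k. (1 - q powi (int n - int i + 1)) / (1 - q powi int i))"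
    using True by (simp add: qbinom_def img prod.reindex)
  also have "\<dots> = (\<Prod>i=1..k. (1 - q ^ (n + 1 - i)) / (1 - q ^ i))"
  proof (rule prod.cong[OF refl])
    fix i assume "i \<in> {1..k}"
    then have "int n - int i + 1 = int (n + 1 - i)"
      using True by auto
    then show "(1 - q powi (int n - int i + 1)) / (1 - q powi int i)
        = (1 - q ^ (n + 1 - i)) / (1 - q ^ i)"
      by (simp only: power_int_of_nat)
  qed
  also have "\<dots> = qb q n k"
    using qb_mult_prod[OF True, of q] assms
    by (simp add: prod_dividef divide_eq_eq)
  finally show ?thesis .
qed (simp add: qbinom_def qb_eq_0)

lemma qvar_power_neq_1:
  assumes "i > 0"
  shows "qvar ^ i \<noteq> 1"
proof
  assume "qvar ^ i = 1"
  moreover have "qvar ^ i = to_fract ([:0, 1:] ^ i)"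
    by (induction i) (simp_all only: qvar_def power_0 power_Suc to_fract_1 to_fract_mult)
  ultimately have "to_fract ([:0, 1:] ^ i) = to_fract (1 :: rat poly)"
    by simp
  then have "degree ([:0, 1::rat:] ^ i) = degree (1 :: rat poly)"
    by (simp only: to_fract_eq_iff)
  then show False
    using assms by (simp add: degree_power_eq)
qed

section \<open>A \<open>q\<close>-Vandermonde type identity\<close>

lemma choose_two_Suc [simp]: "Suc n choose 2 = n + (n choose 2)"
  by (simp add: numeral_2_eq_2)

text \<open>Induction on \<open>a\<close>. The first Pascal rule applied to
  \<open>qb q (Suc a) s\<close> leaves differences \<open>qb q (n - s) t - qb q (p - s) t\<close>;
  the second rule evaluates each as a power of \<open>q\<close> times
  \<open>qb q (p - s) (t - 1)\<close>, and the factor \<open>q ^ s\<close> in \<open>f s\<close>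
  makes the total power independent of \<open>s\<close>.\<close>

lemma sum_qb_qb:
  fixes q :: "'a::comm_ring_1"
  assumes "a \<le> n" "t \<le> n"
  shows "(\<Sum>s\<le>a. (- 1) ^ s * q ^ (s choose 2) * qb q a s * qb q (n - s) t)
    = q ^ (a * (n - t)) * qb q (n - a) (n - t)"
  using assms
proof (induction a arbitrary: n t)
  case 0
  then show ?case by (simp add: qb_symmetric binomial_eq_0)
next
  case (Suc a)
  \<comment> \<open>Since \<open>(s + 1 choose 2) = s + (s choose 2)\<close>, the weight at
    \<open>s + 1\<close> is \<open>- f s\<close>; multiplied by \<open>q ^ Suc s\<close> it is
    \<open>f (Suc s)\<close>. So both halves of the Pascal expansion are sums with weight
    \<open>f\<close>.\<close>
  define f where "f s = (- 1) ^ s * q ^ (s choose 2) * q ^ s" for s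
  obtain p where n: "n = Suc p" and p: "a \<le> p"
    using Suc.prems by (metis Suc_le_D Suc_le_mono)
  let ?S = "\<Sum>s\<le>Suc a. (- 1) ^ s * q ^ (s choose 2) * qb q (Suc a) s * qb q (n - s) t"
  have "?S = qb q n t + (\<Sum>s\<le>a. - f s * qb q (Suc a) (Suc s) * qb q (p - s) t)"
    by (subst sum.atMost_Suc_shift)
      (simp add: f_def n power_add algebra_simps numeral_2_eq_2 del: qb.simps(3))
  also have "\<dots> = (qb q n t + (\<Sum>s\<le>a. - f s * q ^ Suc s * qb q a (Suc s) * qb q (p - s) t))
      - (\<Sum>s\<le>a. f s * qb q a s * qb q (p - s) t)"
    by (simp add: algebra_simps sum.distrib sum_subtractf sum_negf)
  also have "qb q n t + (\<Sum>s\<le>a. - f s * q ^ Suc s * qb q a (Suc s) * qb q (p - s) t)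
      = (\<Sum>s\<le>Suc a. f s * qb q a s * qb q (n - s) t)"
    by (subst sum.atMost_Suc_shift) (simp add: f_def n power_add algebra_simps numeral_2_eq_2)
  also have "\<dots> = (\<Sum>s\<le>a. f s * qb q a s * qb q (n - s) t)"
    by (simp add: qb_eq_0)
  finally have S: "?S = (\<Sum>s\<le>a. f s * qb q a s * (qb q (n - s) t - qb q (p - s) t))"
    by (simp add: algebra_simps sum_subtractf)
  show ?case
  proof (cases t)
    case 0
    then show ?thesis
      using S Suc.prems by (simp add: qb_eq_0)
  next
    case (Suc u)
    have "?S = (\<Sum>s\<le>a. q ^ (n - t) * ((- 1) ^ s * q ^ (s choose 2) * qb q a s * qb q (p - s) u))"
      unfolding S
    proof (rule sum.cong[OF refl])
      fix s assume "s \<in> {..a}"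
      then have ns: "n - s = Suc (p - s)" using n p by auto
      show "f s * qb q a s * (qb q (n - s) t - qb q (p - s) t)
        = q ^ (n - t) * ((- 1) ^ s * q ^ (s choose 2) * qb q a s * qb q (p - s) u)"
      \<comment> \<open>Otherwise the exponent \<open>p - s - u\<close> is truncated, but then both
        sides vanish.\<close>
      proof (cases "u \<le> p - s")
        case True
        then have "q ^ (n - Suc u) = q ^ s * q ^ (p - s - u)"
          using Suc n \<open>s \<in> {..a}\<close> p by (simp flip: power_add)
        then show ?thesis
          unfolding ns Suc qb_Suc_Suc' f_def
          by (simp add: algebra_simps del: diff_diff_left)
      qed (simp add: ns Suc qb_Suc_Suc' qb_eq_0 del: qb.simps)
    qed
    also have "\<dots> = q ^ (n - t) * (q ^ (a * (p - u)) * qb q (p - a) (p - u))"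
      unfolding sum_distrib_left[symmetric] using Suc.IH[of p u] p Suc.prems n Suc by simp
    also have "\<dots> = q ^ (Suc a * (n - t)) * qb q (n - Suc a) (n - t)"
      using n Suc by (simp add: power_add)
    finally show ?thesis .
  qed
qed

corollary sum_qb_qb_atMost:
  fixes q :: "'a::comm_ring_1"
  assumes "a \<le> n" "t \<le> n"
  shows "(\<Sum>s\<le>n. (- 1) ^ s * q ^ (s choose 2) * qb q a s * qb q (n - s) t)
    = q ^ (a * (n - t)) * qb q (n - a) (n - t)"
proof -
  have "(\<Sum>s\<le>n. (- 1) ^ s * q ^ (s choose 2) * qb q a s * qb q (n - s) t)
      = (\<Sum>s\<le>a. (- 1) ^ s * q ^ (s choose 2) * qb q a s * qb q (n - s) t)"
    using assms by (intro sum.mono_neutral_right) (auto simp: qb_eq_0)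
  then show ?thesis using sum_qb_qb[OF assms, of q] by simp
qed

section \<open>Sums along the antidiagonals of the \<open>q\<close>-Pascal triangle\<close>

text \<open>The weight \<open>g\<close> is arbitrary so that the Pascal rules become operations on
  weights.\<close>

definition qb_sum :: "'a::comm_ring_1 \<Rightarrow> (nat \<Rightarrow> 'a) \<Rightarrow> nat \<Rightarrow> 'a" where
  "qb_sum q g n = (\<Sum>k\<le>n. g k * qb q (n - k) k)"

text \<open>Terms with \<open>2 * k > n\<close> vanish; \<open>d\<close> turns truncated exponents
  into ordinary sums.\<close>

lemma qb_sum_cong:
  assumes "\<And>k d. n = 2 * k + d \<Longrightarrow> g k = h k"
  shows "qb_sum q g n = qb_sum q h n"
  unfolding qb_sum_def
proof (rule sum.cong[OF refl])
  fix k assume "k \<in> {..n}"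
  show "g k * qb q (n - k) k = h k * qb q (n - k) k"
  proof (cases "2 * k \<le> n")
    case True
    then show ?thesis using assms[of k "n - 2 * k"] by simp
  qed (simp add: qb_eq_0)
qed

lemma qb_sum_mult: "qb_sum q (\<lambda>k. c * g k) n = c * qb_sum q g n"
  by (simp add: qb_sum_def sum_distrib_left mult.assoc)

text \<open>First Pascal rule on every term except \<open>k = 0\<close>, which is returned to the
  first sum after reindexing.\<close>

lemma qb_sum_Suc_Suc:
  "qb_sum q g (Suc (Suc n)) = qb_sum q (\<lambda>k. q ^ k * g k) (Suc n) + qb_sum q (\<lambda>k. g (Suc k)) n"
proof -
  have "qb_sum q g (Suc (Suc n)) = g 0 + (\<Sum>k\<le>n. g (Suc k) * qb q (Suc n - k) (Suc k))"
    unfolding qb_sum_def by (subst sum.atMost_Suc_shift) simp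
  also have "(\<Sum>k\<le>n. g (Suc k) * qb q (Suc n - k) (Suc k))
      = (\<Sum>k\<le>n. q ^ Suc k * g (Suc k) * qb q (n - k) (Suc k)) + qb_sum q (\<lambda>k. g (Suc k)) n"
    unfolding qb_sum_def sum.distrib[symmetric]
    by (rule sum.cong) (auto simp: Suc_diff_le algebra_simps)
  also have "g 0 + ((\<Sum>k\<le>n. q ^ Suc k * g (Suc k) * qb q (n - k) (Suc k)) + qb_sum q (\<lambda>k. g (Suc k)) n)
      = qb_sum q (\<lambda>k. q ^ k * g k) (Suc n) + qb_sum q (\<lambda>k. g (Suc k)) n"
    using sum.atMost_Suc_shift[of "\<lambda>k. q ^ k * g k * qb q (Suc n - k) k" n]
    by (simp add: qb_sum_def algebra_simps)
  finally show ?thesis .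
qed

text \<open>The same with the second Pascal rule, whose exponent is
  \<open>(n - k) - k\<close>.\<close>

lemma qb_sum_Suc_Suc':
  "qb_sum q g (Suc (Suc n)) = qb_sum q g (Suc n) + qb_sum q (\<lambda>k. q ^ (n - 2 * k) * g (Suc k)) n"
proof -
  have "qb_sum q g (Suc (Suc n)) = g 0 + (\<Sum>k\<le>n. g (Suc k) * qb q (Suc n - k) (Suc k))"
    unfolding qb_sum_def by (subst sum.atMost_Suc_shift) simp
  also have "(\<Sum>k\<le>n. g (Suc k) * qb q (Suc n - k) (Suc k))
      = (\<Sum>k\<le>n. g (Suc k) * qb q (n - k) (Suc k)) + qb_sum q (\<lambda>k. q ^ (n - 2 * k) * g (Suc k)) n"
    unfolding qb_sum_def sum.distrib[symmetric]
    by (rule sum.cong) (auto simp: Suc_diff_le qb_Suc_Suc' algebra_simps mult_2 mult_2_right simp del: qb.simps)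
  also have "g 0 + ((\<Sum>k\<le>n. g (Suc k) * qb q (n - k) (Suc k))
        + qb_sum q (\<lambda>k. q ^ (n - 2 * k) * g (Suc k)) n)
      = qb_sum q g (Suc n) + qb_sum q (\<lambda>k. q ^ (n - 2 * k) * g (Suc k)) n"
    using sum.atMost_Suc_shift[of "\<lambda>k. g k * qb q (Suc n - k) k" n]
    by (simp add: qb_sum_def algebra_simps)
  finally show ?thesis .
qed

text \<open>The first rule writes \<open>f (n + 3)\<close> as the difference of the
  \<open>g\<close>-sums at \<open>n + 2\<close> and \<open>n + 1\<close>. The second rule evaluates
  this difference as a sum at \<open>n\<close>, in which \<open>q ^ (n - 2 * k) * g (Suc k)\<close>
  is a constant times the original weight.\<close>

lemma qb_sum_rec1:
  fixes q :: "'a::comm_ring_1"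
  defines "f \<equiv> qb_sum q (\<lambda>k. (- 1) ^ k * q ^ (k choose 2))"
  shows "f (n + 3) = - (q ^ (n + 1)) * f n"
proof -
  define g where "g = (\<lambda>k. q ^ k * ((- 1) ^ k * q ^ (k choose 2)))"
  have "f (n + 3) = qb_sum q g (Suc (Suc n)) + qb_sum q (\<lambda>k. - 1 * g k) (Suc n)"
    unfolding f_def g_def using qb_sum_Suc_Suc[of q _ "Suc n"]
    by (simp add: numeral_3_eq_3 power_add algebra_simps)
  also have "\<dots> = qb_sum q (\<lambda>k. q ^ (n - 2 * k) * g (Suc k)) n"
    unfolding qb_sum_mult qb_sum_Suc_Suc'[of q g n] by simp
  also have "\<dots> = qb_sum q (\<lambda>k. - (q ^ (n + 1)) * ((- 1) ^ k * q ^ (k choose 2))) n"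
    by (rule qb_sum_cong) (simp add: g_def power_add mult_2 mult_2_right algebra_simps)
  finally show ?thesis
    unfolding f_def qb_sum_mult .
qed

text \<open>Here the weight also depends on \<open>n\<close>. The second rule expresses
  \<open>f (n + 3)\<close> through \<open>h (n + 2)\<close> and \<open>h (n + 1)\<close>, the first
  relates these to \<open>f n\<close>, and \<open>h (n + 1)\<close> cancels. The sign is negative
  because the factor \<open>(- 1) ^ n\<close> of the trace is not yet included.\<close>

lemma qb_sum_rec2:
  fixes q :: "'a::comm_ring_1"
  defines "f \<equiv> (\<lambda>n. qb_sum q (\<lambda>k. (- 1) ^ k * q ^ ((n - k choose 2) + k * k)) n)"
  shows "f (n + 3) = - (q ^ (2 * n + 2)) * f n"
proof -
  \<comment> \<open>The weight of \<open>f\<close> times \<open>q ^ (- k)\<close>, written with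
    \<open>k * (k - 1)\<close> so that no inverse of \<open>q\<close> is required.\<close>
  define g where "g = (\<lambda>n k. (- 1) ^ k * q ^ ((n - k choose 2) + k * (k - 1)))"
  define h where "h = (\<lambda>n. qb_sum q (g n) n)"
  have kk: "k * k = k + k * (k - 1)" for k :: nat
    by (cases k) auto
  have h: "h (n + 2) = q ^ (n + 1) * h (n + 1) - q ^ n * f n"
  proof -
    have "qb_sum q (\<lambda>k. q ^ k * g (n + 2) k) (Suc n) = qb_sum q (\<lambda>k. q ^ (n + 1) * g (n + 1) k) (Suc n)"
    proof (rule qb_sum_cong)
      fix k d assume n: "Suc n = 2 * k + d"
      then have "n + 2 - k = Suc (k + d)" "n + 1 - k = k + d"
        by auto
      then have "k + ((n + 2 - k choose 2) + k * (k - 1))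
          = (n + 1) + ((n + 1 - k choose 2) + k * (k - 1))"
        using n by simp
      then show "q ^ k * g (n + 2) k = q ^ (n + 1) * g (n + 1) k"
        unfolding g_def by (simp only: mult.left_commute[of "q ^ _" "(- 1) ^ k"] flip: power_add)
    qed
    moreover have "qb_sum q (\<lambda>k. g (n + 2) (Suc k)) n
        = qb_sum q (\<lambda>k. - (q ^ n) * ((- 1) ^ k * q ^ ((n - k choose 2) + k * k))) n"
      by (rule qb_sum_cong) (auto simp: g_def power_add mult_2 mult_2_right algebra_simps Suc_diff_le)
    ultimately show ?thesis
      using qb_sum_Suc_Suc[of q "g (n + 2)" n]
      by (simp only: h_def f_def qb_sum_mult) (simp add: numeral_2_eq_2)
  qed
  have "f (n + 3) = q ^ (n + 2) * (h (n + 2) - q ^ (n + 1) * h (n + 1))"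
  proof -
    let ?F = "\<lambda>k. (- 1) ^ k * q ^ ((n + 3 - k choose 2) + k * k)"
    have "qb_sum q ?F (Suc (Suc n)) = qb_sum q (\<lambda>k. q ^ (n + 2) * g (n + 2) k) (Suc (Suc n))"
    proof (rule qb_sum_cong)
      fix k d assume n: "Suc (Suc n) = 2 * k + d"
      then have "n + 3 - k = Suc (k + d)" "n + 2 - k = k + d"
        by auto
      then have "(n + 3 - k choose 2) + k * k = (n + 2) + ((n + 2 - k choose 2) + k * (k - 1))"
        using n kk[of k] by simp
      then show "?F k = q ^ (n + 2) * g (n + 2) k"
        unfolding g_def by (simp only: mult.left_commute[of "q ^ _" "(- 1) ^ k"] flip: power_add)
    qed
    moreover have "qb_sum q (\<lambda>k. q ^ (Suc n - 2 * k) * ?F (Suc k)) (Suc n)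
        = qb_sum q (\<lambda>k. - (q ^ (n + 2) * q ^ (n + 1)) * g (n + 1) k) (Suc n)"
    proof (rule qb_sum_cong)
      fix k d assume n: "Suc n = 2 * k + d"
      then have "n + 3 - Suc k = Suc (k + d)" "n + 1 - k = k + d" "Suc n - 2 * k = d"
        by auto
      then have e: "(Suc n - 2 * k) + ((n + 3 - Suc k choose 2) + Suc k * Suc k)
          = (n + 2) + (n + 1) + ((n + 1 - k choose 2) + k * (k - 1))"
        using n kk[of k] by simp
      have "q ^ (Suc n - 2 * k) * ?F (Suc k)
          = - ((- 1) ^ k * q ^ ((Suc n - 2 * k) + ((n + 3 - Suc k choose 2) + Suc k * Suc k)))"
        unfolding power_add[of q "Suc n - 2 * k"] by (simp only: power_Suc ac_simps) simp
      also have "\<dots> = - (q ^ (n + 2) * q ^ (n + 1)) * g (n + 1) k"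
        unfolding e g_def power_add[of q "n + 2 + (n + 1)"] power_add[of q "n + 2" "n + 1"]
        by (simp only: mult_minus_left mult_minus_right ac_simps)
      finally show "q ^ (Suc n - 2 * k) * ?F (Suc k) = - (q ^ (n + 2) * q ^ (n + 1)) * g (n + 1) k" .
    qed
    ultimately show ?thesis
      using qb_sum_Suc_Suc'[of q ?F "Suc n"]
      by (simp only: f_def h_def qb_sum_mult) (simp add: numeral_3_eq_3 algebra_simps)
  qed
  then show ?thesis
    unfolding h by (simp add: algebra_simps power_add mult_2 mult_2_right)
qed

section \<open>Closed forms of the antidiagonal sums by residue of \<open>n\<close> modulo 3\<close>

lemma induct_3 [case_names 1 2 3 4]:
  fixes P :: "nat \<Rightarrow> bool"
  assumes "P 0" "P 1" "P 2" "\<And>n. P n \<Longrightarrow> P (n + 3)"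
  shows "P n"
proof (induction n rule: less_induct)
  case (less n)
  have "n = 0 \<or> n = 1 \<or> n = 2 \<or> (\<exists>m. n = m + 3)"
    by presburger
  then show ?case
    using assms less.IH by auto
qed

lemma atMost_2: "{..2::nat} = {0, 1, 2}"
  by auto

lemma qb_sum_closed1:
  fixes q :: "'a::comm_ring_1"
  shows "qb_sum q (\<lambda>k. (- 1) ^ k * q ^ (k choose 2)) n
    = (if n mod 3 = 2 then 0 else (- 1) ^ (n div 3) * q ^ (n * (n - 1) div 6))"
proof (induction n rule: induct_3)
  case (4 n)
  \<comment> \<open>The increment is a multiple of 6, so the quotient shifts by exactly
    \<open>n + 1\<close>, as the recursion demands.\<close>
  have "(n + 3) * (n + 3 - 1) = n * (n - 1) + (n + 1) * 6"
    by (cases n) (simp_all add: algebra_simps)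
  then have "(n + 3) * (n + 3 - 1) div 6 = n * (n - 1) div 6 + (n + 1)"
    by simp
  moreover have "(n + 3) mod 3 = n mod 3" "(n + 3) div 3 = Suc (n div 3)"
    by simp_all
  ultimately show ?case
    unfolding qb_sum_rec1 4 by (simp only: power_add power_Suc) simp
qed (simp_all add: qb_sum_def atMost_2 binomial_eq_0 qb_eq_0 choose_two)

lemma qb_sum_closed2:
  fixes q :: "'a::comm_ring_1"
  shows "qb_sum q (\<lambda>k. (- 1) ^ k * q ^ ((n - k choose 2) + k * k)) n
    = (if n mod 3 = 2 then 0 else (- 1) ^ (n div 3) * q ^ (n * (n - 1) div 3))"
proof (induction n rule: induct_3)
  case (4 n)
  have "(n + 3) * (n + 3 - 1) = n * (n - 1) + (2 * n + 2) * 3"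
    by (cases n) (simp_all add: algebra_simps)
  then have "(n + 3) * (n + 3 - 1) div 3 = n * (n - 1) div 3 + (2 * n + 2)"
    by simp
  moreover have "(n + 3) mod 3 = n mod 3" "(n + 3) div 3 = Suc (n div 3)"
    by simp_all
  ultimately show ?case
    unfolding qb_sum_rec2 4 by (simp only: power_add power_Suc) simp
qed (simp_all add: qb_sum_def atMost_2 binomial_eq_0 qb_eq_0 choose_two)

section \<open>Closed walks and matrix powers\<close>

text \<open>Matrices are plain functions with an explicit index set, so their size may depend on the
  variable \<open>n\<close>.\<close>

definition mat_mult :: "'b set \<Rightarrow> ('b \<Rightarrow> 'b \<Rightarrow> 'a::comm_ring_1) \<Rightarrow> ('b \<Rightarrow> 'b \<Rightarrow> 'a) \<Rightarrow> 'b \<Rightarrow> 'b \<Rightarrow> 'a" where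
  "mat_mult A M N = (\<lambda>x y. \<Sum>t\<in>A. M x t * N t y)"

fun mat_pow :: "'b set \<Rightarrow> ('b \<Rightarrow> 'b \<Rightarrow> 'a::comm_ring_1) \<Rightarrow> nat \<Rightarrow> 'b \<Rightarrow> 'b \<Rightarrow> 'a" where
  "mat_pow A M 0 = (\<lambda>x y. of_bool (x = y))"
| "mat_pow A M (Suc j) = mat_mult A (mat_pow A M j) M"

lemma mat_mult_assoc: "mat_mult A (mat_mult A L M) N = mat_mult A L (mat_mult A M N)"
proof (intro ext)
  fix x y
  show "mat_mult A (mat_mult A L M) N x y = mat_mult A L (mat_mult A M N) x y"
    unfolding mat_mult_def sum_distrib_left sum_distrib_right
    by (subst sum.swap) (simp add: mult.assoc)
qed

lemma sum_of_bool_mult: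
  assumes "finite A" "x \<in> A"
  shows "(\<Sum>t\<in>A. of_bool (x = t) * f t) = (f x :: 'a::comm_ring_1)"
    and "(\<Sum>t\<in>A. f t * of_bool (t = x)) = f x"
proof -
  have "of_bool (x = t) * f t = (if t = x then f t else 0)"
    and "f t * of_bool (t = x) = (if t = x then f t else 0)" for t
    by auto
  then show "(\<Sum>t\<in>A. of_bool (x = t) * f t) = f x" "(\<Sum>t\<in>A. f t * of_bool (t = x)) = f x"
    using assms by simp_all
qed

lemma sum_PiE_insert:
  assumes "x \<notin> S"
  shows "(\<Sum>f\<in>insert x S \<rightarrow>\<^sub>E A. g f) = (\<Sum>f\<in>S \<rightarrow>\<^sub>E A. \<Sum>y\<in>A. g (f(x := y)))"
proof -
  have "(\<Sum>f\<in>insert x S \<rightarrow>\<^sub>E A. g f) = (\<Sum>(y, f)\<in>A \<times> (S \<rightarrow>\<^sub>E A). g (f(x := y)))"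
    unfolding PiE_insert_eq using inj_combinator[OF assms, of "\<lambda>_. A"]
    by (subst sum.reindex) (auto simp: case_prod_unfold)
  then show ?thesis
    by (subst sum.swap) (simp add: sum.cartesian_product)
qed

text \<open>The weight \<open>h\<close> on the end points is what makes the induction go through;
  \<open>h x y = M y x\<close> closes the walk.\<close>

lemma sum_walks:
  fixes M :: "'b \<Rightarrow> 'b \<Rightarrow> 'a::comm_ring_1"
  assumes "finite A"
  shows "(\<Sum>r\<in>{1..Suc j} \<rightarrow>\<^sub>E A. (\<Prod>k=1..j. M (r k) (r (Suc k))) * h (r 1) (r (Suc j)))
    = (\<Sum>x\<in>A. \<Sum>y\<in>A. mat_pow A M j x y * h x y)"
proof (induction j arbitrary: h)
  case 0
  have "(\<Sum>r\<in>{Suc 0} \<rightarrow>\<^sub>E A. h (r (Suc 0)) (r (Suc 0))) = (\<Sum>x\<in>A. h x x)"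
    using sum_PiE_insert[of "Suc 0" "{}" "\<lambda>r. h (r (Suc 0)) (r (Suc 0))" A] by simp
  then show ?case
    using assms by (simp add: sum_of_bool_mult)
next
  case (Suc j)
  \<comment> \<open>The last edge of the walk is summed out and absorbed into the end
    weight.\<close>
  let ?h = "\<lambda>a b. \<Sum>y\<in>A. M b y * h a y"
  have I: "{1..Suc (Suc j)} = insert (Suc (Suc j)) {1..Suc j}"
    by auto
  have "(\<Sum>r\<in>{1..Suc (Suc j)} \<rightarrow>\<^sub>E A.
          (\<Prod>k=1..Suc j. M (r k) (r (Suc k))) * h (r 1) (r (Suc (Suc j))))
      = (\<Sum>r\<in>{1..Suc j} \<rightarrow>\<^sub>E A. (\<Prod>k=1..j. M (r k) (r (Suc k))) * ?h (r 1) (r (Suc j)))"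
    unfolding I
    by (subst sum_PiE_insert) (auto simp: sum_distrib_left mult.assoc intro!: sum.cong)
  also have "\<dots> = (\<Sum>x\<in>A. \<Sum>t\<in>A. mat_pow A M j x t * ?h x t)"
    by (rule Suc.IH)
  also have "\<dots> = (\<Sum>x\<in>A. \<Sum>y\<in>A. mat_pow A M (Suc j) x y * h x y)"
    unfolding mat_pow.simps mat_mult_def sum_distrib_left sum_distrib_right
    by (rule sum.cong[OF refl], subst sum.swap) (simp add: mult.assoc)
  finally show ?case .
qed

text \<open>The factor \<open>k = m\<close> returns to \<open>r 1\<close>; taken out as the end
  weight it supplies the last matrix factor of the trace.\<close>

lemma sum_closed_walks:
  fixes M :: "'b \<Rightarrow> 'b \<Rightarrow> 'a::comm_ring_1"
  assumes "finite A" "m \<ge> 1"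
  shows "(\<Sum>r\<in>{1..m} \<rightarrow>\<^sub>E A. \<Prod>k=1..m. M (r k) (r (if k = m then 1 else k + 1)))
    = (\<Sum>x\<in>A. mat_pow A M m x x)"
proof -
  obtain j where m: "m = Suc j"
    using assms by (cases m) auto
  have "(\<Prod>k=1..m. M (r k) (r (if k = m then 1 else k + 1)))
      = (\<Prod>k=1..j. M (r k) (r (Suc k))) * M (r (Suc j)) (r 1)" for r
    unfolding m by (auto intro!: prod.cong)
  then show ?thesis
    using sum_walks[OF assms(1), where j = j and M = M and h = "\<lambda>x y. M y x"] unfolding m
    by (simp add: mat_mult_def)
qed

lemma mat_pow_1:
  assumes "finite A" "x \<in> A"
  shows "mat_pow A M 1 x y = M x y"
  using assms by (simp add: mat_mult_def sum_of_bool_mult)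

lemma mat_pow_2:
  assumes "finite A" "x \<in> A"
  shows "mat_pow A M 2 x y = mat_mult A M M x y"
proof -
  have "mat_pow A M 2 = mat_mult A (mat_pow A M 1) M"
    by (simp add: numeral_2_eq_2)
  then show ?thesis
    by (simp only: mat_mult_def mat_pow_1[OF assms])
qed

text \<open>If the cube is scalar on \<open>A\<close>, three steps contribute only a factor
  \<open>c\<close>, so exponents reduce modulo 3.\<close>

lemma mat_pow_add_3:
  assumes "finite A"
    and "\<And>x y. x \<in> A \<Longrightarrow> y \<in> A \<Longrightarrow> mat_mult A (mat_mult A M M) M x y = c * of_bool (x = y)"
    and "y \<in> A"
  shows "mat_pow A M (3 * a + j) x y = c ^ a * mat_pow A M j x y"
proof (induction a)
  case (Suc a)
  let ?P = "mat_pow A M (3 * a + j)"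
  have "mat_pow A M (3 * Suc a + j) x y = mat_mult A ?P (mat_mult A (mat_mult A M M) M) x y"
    by (simp add: mat_mult_assoc eval_nat_numeral)
  also have "\<dots> = (\<Sum>t\<in>A. (c * ?P x t) * of_bool (t = y))"
    unfolding mat_mult_def[of A ?P]
    by (rule sum.cong) (use assms in \<open>simp_all add: ac_simps\<close>)
  also have "\<dots> = c * ?P x y"
    using assms by (intro sum_of_bool_mult)
  finally show ?case
    using Suc.IH by (simp add: mult.assoc)
qed simp

section \<open>The matrix of the theorem\<close>

definition qb_mat :: "'a::comm_ring_1 \<Rightarrow> nat \<Rightarrow> nat \<Rightarrow> nat \<Rightarrow> 'a" where
  "qb_mat q n x y = qb q (n - x) y * q ^ (x choose 2) * (- 1) ^ x"

lemma choose_two_add: "(a + b choose 2) = (a choose 2) + (b choose 2) + a * b"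
  by (induction a) (simp_all add: binomial_eq_0)

text \<open>The Vandermonde type identity with \<open>a = n - x\<close> and
  \<open>t = y\<close>.\<close>

lemma qb_mat_square:
  assumes "x \<le> n" "y \<le> n"
  shows "mat_mult {..n} (qb_mat q n) (qb_mat q n) x y
    = (- 1) ^ x * q ^ (x choose 2) * q ^ ((n - x) * (n - y)) * qb q x (n - y)"
proof -
  have "mat_mult {..n} (qb_mat q n) (qb_mat q n) x y = (- 1) ^ x * q ^ (x choose 2)
      * (\<Sum>s\<le>n. (- 1) ^ s * q ^ (s choose 2) * qb q (n - x) s * qb q (n - s) y)"
    unfolding mat_mult_def qb_mat_def sum_distrib_left by (simp add: ac_simps)
  then show ?thesis
    using sum_qb_qb_atMost[of "n - x" n y q] assms by (simp add: mult.assoc)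
qed

text \<open>After inserting the closed form of the square, the remaining sum is the same identity
  with \<open>a\<close> and \<open>n\<close> both equal to \<open>x\<close>; its value contains
  \<open>qb q 0 (x - y)\<close>, which for \<open>y \<le> x\<close> is nonzero only on the
  diagonal.\<close>

lemma qb_mat_cube:
  fixes q :: "'a::comm_ring_1"
  assumes "x \<le> n" "y \<le> n"
  shows "mat_mult {..n} (mat_mult {..n} (qb_mat q n) (qb_mat q n)) (qb_mat q n) x y
    = (- 1) ^ n * q ^ (n choose 2) * of_bool (x = y)"
proof -
  obtain w where n: "n = x + w"
    using assms by (metis le_Suc_ex)
  define g where "g s = (- 1) ^ x * q ^ (x choose 2) * q ^ (w * (n - s)) * qb q x (n - s)
    * qb_mat q n s y" for s
  have "mat_mult {..n} (mat_mult {..n} (qb_mat q n) (qb_mat q n)) (qb_mat q n) x y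
      = (\<Sum>s\<le>n. g s)"
    unfolding mat_mult_def[of _ "mat_mult _ _ _"]
    by (rule sum.cong) (use assms in \<open>auto simp: qb_mat_square g_def n\<close>)
  \<comment> \<open>For \<open>s < w\<close> one has \<open>n - s > x\<close>, so
    \<open>qb q x (n - s)\<close> vanishes.\<close>
  also have "\<dots> = (\<Sum>s\<in>{w..n}. g s)"
    by (rule sum.mono_neutral_right) (auto simp: g_def n qb_eq_0 not_le)
  also have "\<dots> = (\<Sum>i\<le>x. g (i + w))"
    using sum.shift_bounds_cl_nat_ivl[of g 0 w x] by (simp add: n atMost_atLeast0)
  also have "\<dots> = (\<Sum>i\<le>x. (- 1) ^ n * q ^ (n choose 2)
      * ((- 1) ^ i * q ^ (i choose 2) * qb q x i * qb q (x - i) y))"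
  proof (rule sum.cong[OF refl])
    fix i assume "i \<in> {..x}"
    then obtain d where x: "x = i + d"
      by (metis atMost_iff le_Suc_ex)
    have "qb q x d = qb q x i"
      using qb_symmetric[of i x q] by (simp add: x)
    moreover have "n - (i + w) = d" "x - i = d"
      by (simp_all add: n x)
    ultimately have "g (i + w) = ((- 1) ^ x * (- 1) ^ (i + w))
        * q ^ ((x choose 2) + w * d + (i + w choose 2)) * qb q x i * qb q d y"
      by (simp only: g_def qb_mat_def power_add ac_simps)
    also have "(- 1) ^ x * (- 1) ^ (i + w) = (- 1 :: 'a) ^ n * (- 1) ^ i"
      by (simp add: n power_add ac_simps)
    \<comment> \<open>Both sides are expanded for \<open>x = i + d\<close> and
      \<open>n = i + d + w\<close>; this frees the constant \<open>q ^ (n choose 2)\<close> from the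
      sum.\<close>
    also have "(x choose 2) + w * d + (i + w choose 2) = (n choose 2) + (i choose 2)"
      by (simp add: n x choose_two_add algebra_simps)
    finally show "g (i + w) = (- 1) ^ n * q ^ (n choose 2)
      * ((- 1) ^ i * q ^ (i choose 2) * qb q x i * qb q (x - i) y)"
      by (simp only: power_add \<open>x - i = d\<close> ac_simps)
  qed
  also have "\<dots> = (- 1) ^ n * q ^ (n choose 2) * of_bool (x = y)"
  proof (cases "y \<le> x")
    case True
    then show ?thesis
      unfolding sum_distrib_left[symmetric] sum_qb_qb[OF order.refl True]
      by (cases "x - y") auto
  next
    case False
    then show ?thesis
      by (auto simp: qb_eq_0)
  qed
  finally show ?thesis .
qed

section \<open>Traces of the powers of the matrix\<close>

lemma trace_qb_mat:
  "(\<Sum>x\<le>n. mat_pow {..n} (qb_mat q n) 1 x x)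
    = (if n mod 3 = 2 then 0 else (- 1) ^ (n div 3) * q ^ (n * (n - 1) div 6))"
proof -
  have "(\<Sum>x\<le>n. mat_pow {..n} (qb_mat q n) 1 x x) = qb_sum q (\<lambda>k. (- 1) ^ k * q ^ (k choose 2)) n"
    unfolding qb_sum_def
    by (rule sum.cong[OF refl], subst mat_pow_1) (simp_all add: qb_mat_def ac_simps)
  then show ?thesis by (simp only: qb_sum_closed1)
qed

text \<open>Reversing the diagonal sum by \<open>k = n - x\<close> gives the second antidiagonal
  sum, with \<open>(- 1) ^ n\<close> split off from the sign.\<close>

lemma trace_qb_mat_square:
  fixes q :: "'a::comm_ring_1"
  shows "(\<Sum>x\<le>n. mat_pow {..n} (qb_mat q n) 2 x x)
    = (if n mod 3 = 2 then 0 else (- 1) ^ (n + n div 3) * q ^ (n * (n - 1) div 3))"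
proof -
  let ?M = "qb_mat q n"
  have "mat_pow {..n} ?M 2 x x
      = (- 1) ^ x * q ^ (x choose 2) * q ^ ((n - x) * (n - x)) * qb q x (n - x)"
    if "x \<le> n" for x
    using that qb_mat_square[OF that that, of q] by (simp add: mat_pow_2)
  then have "(\<Sum>x\<le>n. mat_pow {..n} ?M 2 x x)
      = (\<Sum>x\<le>n. (- 1) ^ x * q ^ (x choose 2) * q ^ ((n - x) * (n - x)) * qb q x (n - x))"
    by simp
  also have "\<dots> = (\<Sum>k\<le>n. (- 1) ^ n * ((- 1) ^ k * q ^ ((n - k choose 2) + k * k) * qb q (n - k) k))"
  proof (rule sum.reindex_bij_witness[of _ "\<lambda>k. n - k" "\<lambda>k. n - k"])
    fix x assume "x \<in> {..n}"
    then obtain k where n: "n = x + k"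
      by (metis atMost_iff le_Suc_ex)
    then have "n - x = k" "n - k = x"
      by auto
    moreover have "(- 1) ^ n * (- 1) ^ k = (- 1 :: 'a) ^ x"
      by (simp add: n power_add mult.assoc flip: power_mult_distrib)
    ultimately show "(- 1) ^ n * ((- 1) ^ (n - x) * q ^ ((n - (n - x) choose 2) + (n - x) * (n - x))
          * qb q (n - (n - x)) (n - x))
        = (- 1) ^ x * q ^ (x choose 2) * q ^ ((n - x) * (n - x)) * qb q x (n - x)"
      by (simp only: power_add mult.assoc[symmetric])
  qed auto
  also have "\<dots> = (- 1) ^ n * qb_sum q (\<lambda>k. (- 1) ^ k * q ^ ((n - k choose 2) + k * k)) n"
    by (simp add: qb_sum_def sum_distrib_left)
  finally show ?thesis
    unfolding qb_sum_closed2 by (simp add: power_add)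
qed

text \<open>Write \<open>m = 3 * a + j\<close> with \<open>j\<close> equal to 1 or 2: the cubes give
  the \<open>a\<close>-th power of the scalar. What remains is to match the floor exponents exactly
  for \<open>q\<close> and modulo 2 for the sign.\<close>

lemma trace_qb_mat_power:
  fixes q :: "'a::comm_ring_1"
  assumes "m mod 3 \<noteq> 0"
  shows "(\<Sum>x\<le>n. mat_pow {..n} (qb_mat q n) m x x)
    = (if n mod 3 \<noteq> 2
       then (- 1) ^ (((m + n - 1) * m) div 3) * q ^ ((m * n * (n - 1)) div 6)
       else 0)"
proof -
  define a where "a = m div 3"
  define N where "N = n * (n - 1)"
  \<comment> \<open>Evenness of \<open>N\<close> turns \<open>3 * a * N\<close> into a multiple of
    6, so it splits off exactly from the quotient by 6.\<close>
  have N: "N = 2 * (n choose 2)"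
    unfolding N_def choose_two by (rule dvd_mult_div_cancel[symmetric], cases n) auto
  have tr: "(\<Sum>x\<le>n. mat_pow {..n} (qb_mat q n) (3 * a + j) x x)
      = (- 1) ^ (n * a) * q ^ ((n choose 2) * a) * (\<Sum>x\<le>n. mat_pow {..n} (qb_mat q n) j x x)" for j
    unfolding sum_distrib_left
  proof (rule sum.cong[OF refl])
    fix x assume "x \<in> {..n}"
    then have "mat_pow {..n} (qb_mat q n) (3 * a + j) x x
        = ((- 1) ^ n * q ^ (n choose 2)) ^ a * mat_pow {..n} (qb_mat q n) j x x"
      by (intro mat_pow_add_3 qb_mat_cube) auto
    then show "mat_pow {..n} (qb_mat q n) (3 * a + j) x x
        = (- 1) ^ (n * a) * q ^ ((n choose 2) * a) * mat_pow {..n} (qb_mat q n) j x x"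
      by (simp add: power_mult_distrib power_mult)
  qed
  have sgn: "(- 1) ^ i = ((- 1) ^ j :: 'a)" if "even i = even j" for i j
    using that by (simp add: minus_one_power_iff)
  have "m = 3 * a + 1 \<or> m = 3 * a + 2"
    using assms unfolding a_def by presburger
  then show ?thesis
  proof
    assume 1: "m = 3 * a + 1"
    have "m * n * (n - 1) = N + ((n choose 2) * a) * 6"
      unfolding mult.assoc N_def[symmetric] unfolding N 1 by (simp add: algebra_simps)
    then have e: "m * n * (n - 1) div 6 = (n choose 2) * a + N div 6"
      by simp
    have "(m + n - 1) * m = n + (n * a + a * (3 * a + 1)) * 3"
      unfolding 1 by (simp add: algebra_simps)
    then have "(m + n - 1) * m div 3 = n * a + a * (3 * a + 1) + n div 3"
      by simp
    \<comment> \<open>The extra term \<open>a * (3 * a + 1)\<close> is always even.\<close>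
    then have s: "(- 1) ^ ((m + n - 1) * m div 3) = ((- 1) ^ (n * a + n div 3) :: 'a)"
      by (intro sgn) simp
    show ?thesis
      unfolding e s unfolding 1 tr trace_qb_mat by (simp add: power_add N_def ac_simps)
  next
    assume 2: "m = 3 * a + 2"
    have "m * n * (n - 1) = 2 * N + ((n choose 2) * a) * 6"
      unfolding mult.assoc N_def[symmetric] unfolding N 2 by (simp add: algebra_simps)
    then have e: "m * n * (n - 1) div 6 = (n choose 2) * a + N div 3"
      by simp
    have "(m + n - 1) * m = 2 * (n + 1) + (a * (3 * a + 2) + a * (n + 1)) * 3"
      unfolding 2 by (simp add: algebra_simps)
    then have d: "(m + n - 1) * m div 3 = a * (3 * a + 2) + a * (n + 1) + 2 * (n + 1) div 3"
      by simp
    show ?thesis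
    proof (cases "n mod 3 = 2")
      case False
      then have "even (2 * (n + 1) div 3) = even (n + n div 3)"
        by presburger
      \<comment> \<open>Modulo 2, \<open>a * (3 * a + 2) + a * (n + 1)\<close> reduces to
        \<open>n * a\<close>.\<close>
      then have s: "(- 1) ^ ((m + n - 1) * m div 3) = ((- 1) ^ (n * a + (n + n div 3)) :: 'a)"
        unfolding d by (intro sgn) auto
      show ?thesis
        unfolding e s unfolding 2 tr trace_qb_mat_square
        using False by (simp add: power_add N_def ac_simps)
    next
      case True
      then show ?thesis
        unfolding 2 tr trace_qb_mat_square by simp
    qed
  qed
qed

theorem theorem2p4:
  fixes m n :: nat
  assumes "m \<ge> 1" and "n \<ge> 1" and "m mod 3 \<noteq> 0"
  shows "(\<Sum>r\<in>{1..m} \<rightarrow>\<^sub>E {0..n}.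
            \<Prod>k\<in>{1..m}.
              qbinom qvar (int n - int (r k)) (int (r (if k = m then 1 else k + 1)))
              * qvar ^ (r k choose 2) * (-1) ^ r k)
         = (if n mod 3 \<noteq> 2
            then (-1) ^ (((m + n - 1) * m) div 3) * qvar ^ ((m * n * (n - 1)) div 6)
            else 0)"
proof -
  have "(\<Sum>r\<in>{1..m} \<rightarrow>\<^sub>E {0..n}.
            \<Prod>k\<in>{1..m}.
              qbinom qvar (int n - int (r k)) (int (r (if k = m then 1 else k + 1)))
              * qvar ^ (r k choose 2) * (-1) ^ r k)
      = (\<Sum>r\<in>{1..m} \<rightarrow>\<^sub>E {..n}.
            \<Prod>k=1..m. qb_mat qvar n (r k) (r (if k = m then 1 else k + 1)))"
    unfolding atMost_atLeast0
  proof (intro sum.cong prod.cong refl)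
    fix r k assume "r \<in> {1..m} \<rightarrow>\<^sub>E {0..n}" "k \<in> {1..m}"
    \<comment> \<open>This bound makes the integer difference agree with the truncated natural one
      in \<open>qb_mat\<close>.\<close>
    then have "r k \<le> n"
      by (auto simp: PiE_iff)
    then have "int n - int (r k) = int (n - r k)"
      by simp
    then show "qbinom qvar (int n - int (r k)) (int (r (if k = m then 1 else k + 1)))
          * qvar ^ (r k choose 2) * (-1) ^ r k
        = qb_mat qvar n (r k) (r (if k = m then 1 else k + 1))"
      by (simp only: qb_mat_def qbinom_eq_qb[OF qvar_power_neq_1])
  qed
  also have "\<dots> = (\<Sum>x\<le>n. mat_pow {..n} (qb_mat qvar n) m x x)"
    using assms by (intro sum_closed_walks) auto
  finally show ?thesis
    unfolding trace_qb_mat_power[OF assms(3)] .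
qed

end
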